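(* As $k\to\infty$, $$s_k^{\mathtt{HC}}\le 2.91\,\sqrt{k}\,(1+o_k(1)).$$
   Context: $|x-y|$ denotes Euclidean distance. A Hamiltonian cycle $H$ through an $n$-element set $X$, $n\ge 2$, is a cyclic ordering $x_1,\ldots,x_n$ of all points of $X$, with edges $x_ix_{i+1}$, $i=1,\ldots,n$, where $x_{n+1}:=x_1$ (so for $n=2$ the single segment is counted twice). Let $s_k(H)=\left(\sum_{i=1}^n|x_i-x_{i+1}|^k\right)^{1/k}$. For finite $X\subseteq[0,1]^k$, $s_k^{\mathtt{HC}}(X)$ is the minimum of $s_k(H)$ over all Hamiltonian cycles $H$ through $X$; $s_k^{\mathtt{HC}}(n)=\sup\{s_k^{\mathtt{HC}}(X):X\subseteq[0,1]^k,\ |X|=n\}$; and $s_k^{\mathtt{HC}}=\sup_{n\ge 2}s_k^{\mathtt{HC}}(n)$. The notation $o_k(1)$ denotes a quantity depending only on $k$ that tends to $0$ as $k\to\infty$. *)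

theory Defs
  imports "HOL-Analysis.Analysis"
begin

text \<open>
  The dimension varies inside the statement, so points of dimension \<open>k\<close> are functions
  \<open>nat \<Rightarrow> real\<close> whose coordinates are the values on \<open>{..<k}\<close>. The cube is the extensional
  function space, so that distinct elements differ in some coordinate below \<open>k\<close> and
  \<open>card\<close> counts points.
\<close>

definition unit_cube :: "nat \<Rightarrow> (nat \<Rightarrow> real) set" where
  "unit_cube k = {..<k} \<rightarrow>\<^sub>E {0..1}"

definition eucl_dist :: "nat \<Rightarrow> (nat \<Rightarrow> real) \<Rightarrow> (nat \<Rightarrow> real) \<Rightarrow> real" where
  "eucl_dist k x y = L2_set (\<lambda>i. x i - y i) {..<k}"

text \<open>
  A Hamiltonian cycle is given by one of its orderings; the closing edge arises from the index
  modulo the length. For two points both indices give the same segment, which is thus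
  counted twice.
\<close>

definition ham_cycle :: "'a set \<Rightarrow> 'a list \<Rightarrow> bool" where
  "ham_cycle X H \<longleftrightarrow> distinct H \<and> set H = X"

definition s_cycle :: "nat \<Rightarrow> (nat \<Rightarrow> real) list \<Rightarrow> real" where
  "s_cycle k H =
     root k (\<Sum>i<length H. eucl_dist k (H ! i) (H ! ((i + 1) mod length H)) ^ k)"

definition s_HC_set :: "nat \<Rightarrow> (nat \<Rightarrow> real) set \<Rightarrow> real" where
  "s_HC_set k X = Min (s_cycle k ` {H. ham_cycle X H})"

text \<open>The \<open>Min\<close> above is over a finite nonempty set.\<close>

lemma finite_ham_cycles: "finite X \<Longrightarrow> finite {H. ham_cycle X H}"
  by (rule finite_subset[OF _ finite_lists_length_eq[of X "card X"]])
    (auto simp: ham_cycle_def distinct_card)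

lemma ham_cycles_nonempty: "finite X \<Longrightarrow> {H. ham_cycle X H} \<noteq> {}"
  using finite_distinct_list[of X] by (auto simp: ham_cycle_def)

text \<open>
  The suprema are taken in \<^typ>\<open>ereal\<close>, since a real-valued \<open>Sup\<close> is unspecified
  on unbounded sets.
\<close>

definition s_HC_card :: "nat \<Rightarrow> nat \<Rightarrow> ereal" where
  "s_HC_card k n = (SUP X \<in> {X. X \<subseteq> unit_cube k \<and> finite X \<and> card X = n}. ereal (s_HC_set k X))"

definition s_HC :: "nat \<Rightarrow> ereal" where
  "s_HC k = (SUP n \<in> {2..}. s_HC_card k n)"

end

theory Submission
  imports Defs
begin

text \<open>
  Visit the points in the order in which the \<open>k\<close>-dimensional Peano curve passes through them.
  Refine one coordinate at a time, in thirds: a time interval of length \<open>3\<^sup>-\<^sup>e\<close>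
  then corresponds to a box with sides \<open>3\<^sup>-\<^sup>q\<close> or \<open>3\<^sup>-\<^sup>q\<^sup>-\<^sup>1\<close>, and
  consecutive boxes share a face. So two points whose times differ by less than \<open>3\<^sup>-\<^sup>e\<close> lie in
  a box doubled along one axis, and \<open>9\<^sup>u \<le> 1 + 8u\<close> for \<open>0 \<le> u \<le> 1\<close> bounds the
  \<open>k\<close>-th power of its diagonal by \<open>(25k/9 + 27)\<^bsup>k/2\<^esup> 3\<^sup>-\<^sup>e\<close>. Hence the \<open>k\<close>-th power
  of the distance is at most a constant times the time difference; these differences telescope along
  the tour, which yields the stronger bound \<open>s_HC k \<le> 5/3 sqrt k (1 + o(1))\<close>.
\<close>

section \<open>Peano digits, steps and times\<close>

text \<open>The value 2 at \<open>u = 1\<close> keeps \<open>3 * u - peano_digit u\<close> in [0,1],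
  so refinement never leaves the closed cube.\<close>

definition peano_digit :: "real \<Rightarrow> real" where
  "peano_digit u = (if u < 1/3 then 0 else if u < 2/3 then 1 else 2)"

definition peano_step :: "nat \<Rightarrow> (nat \<Rightarrow> real) \<Rightarrow> nat \<Rightarrow> real" where
  "peano_step i x j =
     (if j = i then 3 * x i - peano_digit (x i)
      else if peano_digit (x i) = 1 then 1 - x j else x j)"

text \<open>
  \<open>peano_time k n d\<close> is the time at which the curve passes, truncated to \<open>n\<close> ternary
  digits, when the coordinates are refined cyclically starting from coordinate \<open>d mod k\<close>. The
  reflection in \<open>peano_step\<close> normalises every box so that the curve runs from the corner
  \<open>(0,\<dots>,0)\<close> to the corner \<open>(1,\<dots>,1)\<close>.
\<close>

fun peano_time :: "nat \<Rightarrow> nat \<Rightarrow> nat \<Rightarrow> (nat \<Rightarrow> real) \<Rightarrow> real" where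
  "peano_time k 0 d x = 0"
| "peano_time k (Suc n) d x =
     (peano_digit (x (d mod k)) + peano_time k n (Suc d) (peano_step (d mod k) x)) / 3"

text \<open>
  \<open>side k d e j\<close> is the side in direction \<open>j\<close> of a box after \<open>e\<close> refinements.
\<close>

fun side :: "nat \<Rightarrow> nat \<Rightarrow> nat \<Rightarrow> nat \<Rightarrow> real" where
  "side k d 0 j = 1"
| "side k d (Suc e) j = (if j = d mod k then 1/3 else 1) * side k (Suc d) e j"

definition in_cube :: "nat \<Rightarrow> (nat \<Rightarrow> real) \<Rightarrow> bool" where
  "in_cube k x \<longleftrightarrow> (\<forall>j<k. 0 \<le> x j \<and> x j \<le> 1)"

section \<open>Position in the cube from the time\<close>

lemma in_cube_step: "in_cube k x \<Longrightarrow> i < k \<Longrightarrow> in_cube k (peano_step i x)"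
  unfolding in_cube_def peano_step_def peano_digit_def by (auto dest: spec[of _ i])

lemma peano_digit_cases: "peano_digit u = 0 \<or> peano_digit u = 1 \<or> peano_digit u = 2"
  by (simp add: peano_digit_def)

lemma peano_time_bounds: "0 \<le> peano_time k n d x \<and> peano_time k n d x < 1"
proof (induction n arbitrary: d x)
  case (Suc n)
  show ?case
    using Suc[of "Suc d" "peano_step (d mod k) x"] peano_digit_cases[of "x (d mod k)"] by auto
qed simp

text \<open>So early a time forces the first \<open>e\<close> digits to be 0. Hence no step
  reflects, and each keeps the lower third: the box sits at the entry corner.\<close>

lemma peano_time_entry:
  assumes "0 < k" "in_cube k x" "e \<le> n" "peano_time k n d x < 1 / 3 ^ e" "j < k"
  shows "x j \<le> side k d e j"
  using assms
proof (induction e arbitrary: n d x)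
  case 0
  then show ?case by (simp add: in_cube_def)
next
  case (Suc e)
  define i where "i = d mod k"
  have i: "i < k" using Suc.prems by (simp add: i_def)
  obtain m where n: "n = Suc m" using Suc.prems(3) by (cases n) auto
  define x' where "x' = peano_step i x"
  have x': "in_cube k x'" unfolding x'_def using Suc.prems i by (intro in_cube_step)
  have t: "peano_digit (x i) + peano_time k m (Suc d) x' < 1 / 3 ^ e"
    using Suc.prems(4) by (simp add: n x'_def i_def field_simps)
  have "(1::real) / 3 ^ e \<le> 1" by simp
  then have a: "peano_digit (x i) = 0"
    using t peano_digit_cases[of "x i"] peano_time_bounds[of k m "Suc d" x'] by linarith
  have "x' j \<le> side k (Suc d) e j"
    using Suc.IH[of x' m "Suc d"] x' t a Suc.prems n by simp
  then show ?case using a by (auto simp: x'_def peano_step_def i_def[symmetric])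
qed

text \<open>Dual to the entry corner: the first \<open>e\<close> digits are all 2, which again
  causes no reflection.\<close>

lemma peano_time_exit:
  assumes "0 < k" "in_cube k x" "e \<le> n" "1 - 1 / 3 ^ e \<le> peano_time k n d x" "j < k"
  shows "1 - side k d e j \<le> x j"
  using assms
proof (induction e arbitrary: n d x)
  case 0
  then show ?case by (simp add: in_cube_def)
next
  case (Suc e)
  define i where "i = d mod k"
  have i: "i < k" using Suc.prems by (simp add: i_def)
  obtain m where n: "n = Suc m" using Suc.prems(3) by (cases n) auto
  define x' where "x' = peano_step i x"
  have x': "in_cube k x'" unfolding x'_def using Suc.prems i by (intro in_cube_step)
  have t: "3 - 1 / 3 ^ e \<le> peano_digit (x i) + peano_time k m (Suc d) x'"
    using Suc.prems(4) by (simp add: n x'_def i_def field_simps)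
  have "(1::real) / 3 ^ e \<le> 1" by simp
  then have a: "peano_digit (x i) = 2"
    using t peano_digit_cases[of "x i"] peano_time_bounds[of k m "Suc d" x'] by linarith
  have "1 - side k (Suc d) e j \<le> x' j"
    using Suc.IH[of x' m "Suc d"] x' t a Suc.prems n by simp
  then show ?case using a by (auto simp: x'_def peano_step_def i_def[symmetric])
qed

lemma side_pos: "0 < side k d e j"
  by (induction e arbitrary: d) auto

text \<open>The case of adjacent thirds: \<open>x\<close> is about to leave its third and
  \<open>y\<close> has just entered the next. Exactly one of the two digits is 1, so exactly one
  point is reflected; this makes exit and entry corner coincide. Across the common face
  (\<open>j = i\<close>) the two boxes add up, while in every other direction they span the same
  interval.\<close>

lemma peano_time_close_aux:
  assumes k: "0 < k" and x': "in_cube k (peano_step i x)" and y': "in_cube k (peano_step i y)"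
    and e: "e \<le> m" and i: "i = d mod k"
    and a: "peano_digit (y i) = peano_digit (x i) + 1"
    and t: "1 + peano_time k m (Suc d) (peano_step i y)
              - peano_time k m (Suc d) (peano_step i x) < 1 / 3 ^ e"
    and j: "j < k"
  shows "\<bar>x j - y j\<bar> \<le> (if j = i then 2 else 1) * side k d (Suc e) j"
proof -
  note b = peano_time_bounds[of k m "Suc d"]
  have X: "1 - side k (Suc d) e j \<le> peano_step i x j"
    using peano_time_exit[OF k x' e _ j] t b[of "peano_step i y"] by simp
  have Y: "peano_step i y j \<le> side k (Suc d) e j"
    using peano_time_entry[OF k y' e _ j] t b[of "peano_step i x"] by simp
  have X1: "peano_step i x j \<le> 1" and Y0: "0 \<le> peano_step i y j"
    using x' y' j by (auto simp: in_cube_def)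
  have ax: "peano_digit (x i) = 0 \<or> peano_digit (x i) = 1"
    using a peano_digit_cases[of "x i"] peano_digit_cases[of "y i"] by auto
  show ?thesis
    using X Y X1 Y0 ax a i by (auto simp: peano_step_def abs_if split: if_splits)
qed

lemma peano_time_close:
  assumes "0 < k" "in_cube k x" "in_cube k y" "e \<le> n"
    "\<bar>peano_time k n d x - peano_time k n d y\<bar> < 1 / 3 ^ e"
  shows "\<exists>i. \<forall>j<k. \<bar>x j - y j\<bar> \<le> (if j = i then 2 else 1) * side k d e j"
  using assms
proof (induction e arbitrary: n d x y)
  case 0
  then show ?case by (fastforce simp: in_cube_def abs_if)
next
  case (Suc e)
  define i where "i = d mod k"
  have i: "i < k" using Suc.prems by (simp add: i_def)
  obtain m where n: "n = Suc m" using Suc.prems(4) by (cases n) auto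
  have em: "e \<le> m" using Suc.prems(4) n by simp
  define x' y' where "x' = peano_step i x" and "y' = peano_step i y"
  have x': "in_cube k x'" and y': "in_cube k y'"
    unfolding x'_def y'_def using Suc.prems i by (auto intro: in_cube_step)
  define s t where "s = peano_time k m (Suc d) x'" and "t = peano_time k m (Suc d) y'"
  have "\<bar>(peano_digit (x i) + s) / 3 - (peano_digit (y i) + t) / 3\<bar> < 1 / 3 ^ e / 3"
    using Suc.prems(5) by (simp add: n s_def t_def x'_def y'_def i_def mult.commute)
  moreover have scale: "\<bar>a / 3 - b / 3\<bar> < c / 3 \<Longrightarrow> \<bar>a - b\<bar> < c" for a b c :: real
    by linarith
  ultimately have T: "\<bar>peano_digit (x i) + s - (peano_digit (y i) + t)\<bar> < 1 / 3 ^ e"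
    using scale by blast
  have one: "(1::real) / 3 ^ e \<le> 1" by simp
  have st: "0 \<le> s" "s < 1" "0 \<le> t" "t < 1"
    using peano_time_bounds unfolding s_def t_def by auto
  \<comment> \<open>After scaling by 3 the times are less than 1 apart, and so are \<open>s\<close>
    and \<open>t\<close>; the integer digits therefore differ by less than 2.\<close>
  consider "peano_digit (x i) = peano_digit (y i)"
    | "peano_digit (y i) = peano_digit (x i) + 1"
    | "peano_digit (x i) = peano_digit (y i) + 1"
    using T one st peano_digit_cases[of "x i"] peano_digit_cases[of "y i"] by fastforce
  then show ?case
  proof cases
    \<comment> \<open>Equal digits mean the same reflection for both points, so
      \<open>peano_step\<close> only stretches the difference in coordinate \<open>i\<close> by
      3.\<close>
    case 1
    then have "\<bar>s - t\<bar> < 1 / 3 ^ e" using T by simp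
    then obtain l where l: "\<And>j. j < k \<Longrightarrow>
        \<bar>x' j - y' j\<bar> \<le> (if j = l then 2 else 1) * side k (Suc d) e j"
      using Suc.IH[OF Suc.prems(1) x' y' em, of "Suc d"] unfolding s_def t_def by blast
    have "\<bar>x j - y j\<bar> \<le> (if j = l then 2 else 1) * side k d (Suc e) j" if "j < k" for j
      using l[OF that] 1
      by (auto simp: x'_def y'_def peano_step_def i_def[symmetric] abs_if split: if_splits)
    then show ?thesis by blast
  next
    case 2
    then have "1 + t - s < 1 / 3 ^ e" using T by linarith
    then show ?thesis
      using peano_time_close_aux[OF Suc.prems(1) x'[unfolded x'_def] y'[unfolded y'_def] em i_def 2]
      unfolding s_def t_def x'_def y'_def by blast
  next
    case 3
    then have "1 + s - t < 1 / 3 ^ e" using T by linarith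
    then show ?thesis
      using peano_time_close_aux[OF Suc.prems(1) y'[unfolded y'_def] x'[unfolded x'_def] em i_def 3]
      unfolding s_def t_def x'_def y'_def by (metis abs_minus_commute)
  qed
qed

section \<open>Sides and diagonals of boxes\<close>

text \<open>For \<open>j < k\<close>, \<open>(d + k - 1 - j) div k\<close> counts the numbers below
  \<open>d\<close> congruent to \<open>j\<close> modulo \<open>k\<close>, that is, the refinements
  of coordinate \<open>j\<close> before step \<open>d\<close>.\<close>

lemma Suc_count_div:
  assumes "j < (k::nat)"
  shows "(Suc d + k - 1 - j) div k = (d + k - 1 - j) div k + (if j = d mod k then 1 else 0)"
proof -
  have eq: "Suc d + k - 1 - j = Suc (d + k - 1 - j)" using assms by simp
  define q r where "q = d div k" and "r = d mod k"
  have d: "d = k * q + r" and r: "r < k" using assms by (auto simp: q_def r_def)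
  have "Suc (d + k - 1 - j) mod k = 0 \<longleftrightarrow> j = r"
  proof -
    have "Suc (d + k - 1 - j) = k * q + (r + (k - j))" using d assms by simp
    then have "Suc (d + k - 1 - j) mod k = (r + (k - j)) mod k" by simp
    also have "\<dots> = 0 \<longleftrightarrow> j = r"
    proof (cases "r < j")
      case True
      then show ?thesis using assms by simp
    next
      case False
      then have "(r + (k - j)) mod k = ((r - j) + k) mod k" using assms by simp
      also have "\<dots> = (r - j) mod k" by (rule mod_add_self2)
      also have "\<dots> = r - j" using r by simp
      finally show ?thesis using False by auto
    qed
    finally show ?thesis .
  qed
  then show ?thesis unfolding eq r_def by (simp add: div_Suc)
qed

lemma side_eq:
  assumes "j < k"
  shows "side k d e j = 3 ^ ((d + k - 1 - j) div k) / 3 ^ ((d + e + k - 1 - j) div k)"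
proof (induction e arbitrary: d)
  case (Suc e)
  show ?case using Suc[of "Suc d"] Suc_count_div[OF assms, of d] by auto
qed simp

lemma side_0_eq:
  assumes "j < k" "r < k"
  shows "side k 0 (k * q + r) j = (1 / 3 ^ q) * (if j < r then 1/3 else 1)"
proof -
  have "(k * q + r + k - 1 - j) = k * q + (r + k - 1 - j)" using assms by simp
  then have "(k * q + r + k - 1 - j) div k = q + (r + k - 1 - j) div k"
    using assms by (simp only: div_mult_self4)
  moreover have "(r + k - 1 - j) div k = (if j < r then 1 else 0)"
    using assms by (auto simp: div_nat_eqI)
  ultimately show ?thesis using assms by (simp add: side_eq)
qed

text \<open>Convexity of \<open>exp\<close> puts 9^u below its chord 1 + 8u on [0,1]; take
  \<open>k\<close>-th powers at \<open>u = r / k\<close>. In this form the factor merges with the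
  \<open>k\<close>-th power of a squared diagonal.\<close>

lemma nine_power_le:
  assumes "r \<le> k" "0 < k"
  shows "(9::real) ^ r \<le> (1 + 8 * real r / real k) ^ k"
proof -
  define u where "u = real r / real k"
  have u: "0 \<le> u" "u \<le> 1" using assms by (auto simp: u_def)
  have "exp ((1 - u) *\<^sub>R 0 + u *\<^sub>R ln 9) \<le> (1 - u) * exp 0 + u * exp (ln 9)"
    using u by (intro convex_onD[OF exp_convex]) auto
  then have "exp (u * ln 9) \<le> 1 + 8 * u" by (simp add: algebra_simps)
  then have "exp (u * ln 9) ^ k \<le> (1 + 8 * u) ^ k" by (intro power_mono) auto
  moreover have "exp (u * ln 9) ^ k = exp (real k * (u * ln 9))"
    by (simp add: exp_of_nat_mult)
  moreover have "real k * (u * ln 9) = real r * ln 9" using assms by (simp add: u_def)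
  moreover have "exp (real r * ln 9) = (9::real) ^ r"
    by (simp add: exp_of_nat_mult)
  ultimately show ?thesis by (simp add: u_def)
qed

text \<open>Squared form of the estimate (diagonal)^k * 3^e. Full rounds of refinement cancel
  against \<open>9 ^ e\<close>, so only the incomplete round of \<open>r\<close> steps
  matters.\<close>

lemma sum_side_le:
  assumes "0 < k" "\<And>j. j < k \<Longrightarrow> \<bar>z j\<bar> \<le> (if j = i then 2 else 1) * side k 0 e j"
  shows "(\<Sum>j<k. (z j)\<^sup>2) ^ k * 9 ^ e \<le> (25 / 9 * real k + 27) ^ k"
proof -
  define q r where "q = e div k" and "r = e mod k"
  have e: "e = k * q + r" and r: "r < k" using assms by (auto simp: q_def r_def)
  have "(\<Sum>j<k. (z j)\<^sup>2) \<le>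
      (\<Sum>j<k. (1 / 9 ^ q) * ((if j < r then 1/9 else 1) + (if j = i then 3 else 0)))"
  proof (rule sum_mono)
    fix j assume "j \<in> {..<k}"
    then have j: "j < k" by simp
    have "(z j)\<^sup>2 \<le> ((if j = i then 2 else 1) * side k 0 e j)\<^sup>2"
      using assms(2)[OF j] by (metis abs_ge_zero power2_abs power_mono)
    also have "\<dots> = (1 / 3 ^ q)\<^sup>2 * ((if j = i then 4 else 1) * (if j < r then 1/9 else 1))"
      unfolding e side_0_eq[OF j r] by (simp add: power_mult_distrib power2_eq_square)
    also have "(1 / (3::real) ^ q)\<^sup>2 = 1 / 9 ^ q"
      using power_even_eq[of "3::real" q] power_mult[of "3::real" 2 q] by (simp add: power_divide)
    \<comment> \<open>Doubling a side multiplies its square by 4; for \<open>a \<le> 1\<close> this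
      is absorbed by \<open>4 * a \<le> a + 3\<close>.\<close>
    also have "1 / (9::real) ^ q * ((if j = i then 4 else 1) * (if j < r then 1/9 else 1)) \<le>
        (1 / 9 ^ q) * ((if j < r then 1/9 else 1) + (if j = i then 3 else 0))"
      by (intro mult_left_mono) auto
    finally show "(z j)\<^sup>2 \<le> (1 / 9 ^ q) * ((if j < r then 1/9 else 1) + (if j = i then 3 else 0))" .
  qed
  also have "\<dots> = (1 / 9 ^ q) *
      ((\<Sum>j<k. if j < r then 1/9 else 1) + (\<Sum>j<k. if j = i then 3 else 0))"
    by (simp only: sum_distrib_left[symmetric] sum.distrib)
  also have "\<dots> \<le> (1 / 9 ^ q) * (real k - 8 / 9 * real r + 3)"
  proof (intro mult_left_mono)
    have "(\<Sum>j<k. if j < r then 1/9 else (1::real)) = (\<Sum>j<k. 1 - (if j < r then 8/9 else 0))"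
      by (intro sum.cong) auto
    also have "\<dots> = real k - (\<Sum>j<k. if j < r then 8/9 else 0)" by (simp add: sum_subtractf)
    also have "(\<Sum>j<k. if j < r then 8/9 else (0::real)) = (\<Sum>j<r. 8/9)"
      using r by (intro sum.mono_neutral_cong_right) auto
    finally have "(\<Sum>j<k. if j < r then 1/9 else (1::real)) = real k - 8 / 9 * real r" by simp
    \<comment> \<open>Only an inequality, as \<open>i\<close> may lie outside
      \<open>{..<k}\<close>.\<close>
    moreover have "(\<Sum>j<k. if j = i then 3 else (0::real)) \<le> 3" by (simp add: sum.delta)
    ultimately show "(\<Sum>j<k. if j < r then 1/9 else 1) + (\<Sum>j<k. if j = i then 3 else 0)
        \<le> real k - 8 / 9 * real r + 3" by simp
  qed simp
  finally have S: "(\<Sum>j<k. (z j)\<^sup>2) \<le> (1 / 9 ^ q) * (real k - 8 / 9 * real r + 3)" .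
  have rk: "real r \<le> real k" using r by simp
  have "(\<Sum>j<k. (z j)\<^sup>2) ^ k * 9 ^ e
      \<le> ((1 / 9 ^ q) * (real k - 8 / 9 * real r + 3)) ^ k * 9 ^ e"
    using S by (intro mult_right_mono power_mono sum_nonneg) auto
  also have "\<dots> = (real k - 8 / 9 * real r + 3) ^ k * 9 ^ r"
    by (simp add: e power_mult_distrib power_add power_divide flip: power_mult) (simp add: mult.commute)
  also have "\<dots> \<le> (real k - 8 / 9 * real r + 3) ^ k * (1 + 8 * real r / real k) ^ k"
    using nine_power_le[of r k] r rk by (intro mult_left_mono) auto
  also have "\<dots> = ((real k - 8 / 9 * real r + 3) * (1 + 8 * real r / real k)) ^ k"
    by (simp add: power_mult_distrib)
  also have "\<dots> \<le> (25 / 9 * real k + 27) ^ k"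
  proof (intro power_mono)
    define u where "u = real r / real k"
    have u: "0 \<le> u" "u \<le> 1" using rk assms by (auto simp: u_def)
    have "(real k - 8 / 9 * real r + 3) * (1 + 8 * real r / real k) =
        (real k - 8 / 9 * (u * real k) + 3) * (1 + 8 * u)" using assms by (simp add: u_def)
    \<comment> \<open>Completing the square: (1 - 8u/9)(1 + 8u) is largest at u = 1/2, with value
      5/9 * 5 = 25/9. The rest comes from the doubled side.\<close>
    also have "\<dots> = 25 / 9 * real k + 3 * (1 + 8 * u) - real k * (8 * u - 4)\<^sup>2 / 9"
      by (simp add: field_simps power2_eq_square)
    also have "\<dots> \<le> 25 / 9 * real k + 27"
    proof -
      have "0 \<le> real k * (8 * u - 4)\<^sup>2 / 9" by simp
      moreover have "3 * (1 + 8 * u) \<le> 27" using u by simp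
      ultimately show ?thesis by linarith
    qed
    finally show "(real k - 8 / 9 * real r + 3) * (1 + 8 * real r / real k)
      \<le> 25 / 9 * real k + 27" .
    show "0 \<le> (real k - 8 / 9 * real r + 3) * (1 + 8 * real r / real k)" using rk by simp
  qed
  finally show ?thesis .
qed

section \<open>Distances bounded by time differences\<close>

lemma eucl_dist_power_le:
  assumes k: "0 < k" and x: "in_cube k x" and y: "in_cube k y"
    and e: "e \<le> n" "\<bar>peano_time k n 0 x - peano_time k n 0 y\<bar> < 1 / 3 ^ e"
  shows "eucl_dist k x y ^ k \<le> sqrt ((25 / 9 * real k + 27) ^ k) / 3 ^ e"
proof -
  obtain i where "\<And>j. j < k \<Longrightarrow> \<bar>x j - y j\<bar> \<le> (if j = i then 2 else 1) * side k 0 e j"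
    using peano_time_close[OF k x y e] by blast
  then have *: "(\<Sum>j<k. (x j - y j)\<^sup>2) ^ k * 9 ^ e \<le> (25 / 9 * real k + 27) ^ k"
    by (rule sum_side_le[OF k])
  have "eucl_dist k x y ^ k * 3 ^ e = sqrt ((\<Sum>j<k. (x j - y j)\<^sup>2) ^ k * 9 ^ e)"
    using real_sqrt_power[of 9 e]
    by (simp add: eucl_dist_def L2_set_def real_sqrt_power real_sqrt_mult)
  also have "\<dots> \<le> sqrt ((25 / 9 * real k + 27) ^ k)" using * by simp
  finally show ?thesis by (simp add: field_simps)
qed

text \<open>Apply the box bound at the finest level \<open>e \<le> n\<close> with \<delta> below
  1/3^e. Unless \<open>e = n\<close>, level \<open>e + 1\<close> fails, so 1/3^e is at most
  3\<delta>. The term \<open>1 / 3 ^ n\<close> covers \<open>e = n\<close>, where truncated times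
  may even coincide.\<close>

lemma peano_time_hoelder:
  assumes k: "0 < k" and x: "in_cube k x" and y: "in_cube k y"
  shows "eucl_dist k x y ^ k \<le> 3 * sqrt ((25 / 9 * real k + 27) ^ k) *
    (\<bar>peano_time k n 0 x - peano_time k n 0 y\<bar> + 1 / 3 ^ n)"
proof -
  define C where "C = sqrt ((25 / 9 * real k + 27) ^ k)"
  define \<delta> where "\<delta> = \<bar>peano_time k n 0 x - peano_time k n 0 y\<bar>"
  have C: "0 \<le> C" by (simp add: C_def)
  have \<delta>: "0 \<le> \<delta>" "\<delta> < 1"
    using peano_time_bounds[of k n 0 x] peano_time_bounds[of k n 0 y] by (auto simp: \<delta>_def)
  define E where "E = {e. e \<le> n \<and> \<delta> < 1 / 3 ^ e}"
  have E: "finite E" "0 \<in> E" using \<delta> by (auto simp: E_def)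
  define e where "e = Max E"
  have "e \<in> E" using E Max_in unfolding e_def by blast
  then have e: "e \<le> n" "\<delta> < 1 / 3 ^ e" by (auto simp: E_def)
  have "Suc e \<notin> E" using Max_ge[OF E(1), of "Suc e"] unfolding e_def by auto
  then have "e = n \<or> 1 / 3 ^ Suc e \<le> \<delta>" using e by (auto simp: E_def)
  then have "1 / 3 ^ e \<le> 3 * (\<delta> + 1 / 3 ^ n)"
  proof
    assume "1 / 3 ^ Suc e \<le> \<delta>"
    then have "1 / 3 ^ e \<le> 3 * \<delta>" by (simp add: field_simps)
    also have "\<dots> \<le> 3 * (\<delta> + 1 / 3 ^ n)" by simp
    finally show ?thesis .
  next
    assume "e = n"
    have "(0::real) \<le> 1 / 3 ^ n" by simp
    then show ?thesis unfolding \<open>e = n\<close> using \<delta>(1) by argo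
  qed
  then have "C * (1 / 3 ^ e) \<le> C * (3 * (\<delta> + 1 / 3 ^ n))" using C by (rule mult_left_mono)
  moreover have "eucl_dist k x y ^ k \<le> C / 3 ^ e"
    using eucl_dist_power_le[OF k x y e[unfolded \<delta>_def]] by (simp add: C_def)
  ultimately have "eucl_dist k x y ^ k \<le> C * (3 * (\<delta> + 1 / 3 ^ n))" by simp
  also have "\<dots> = 3 * C * (\<delta> + 1 / 3 ^ n)" by simp
  finally show ?thesis by (simp only: C_def \<delta>_def)
qed

section \<open>The tour in order of time\<close>

text \<open>The forward edges telescope to last minus first, and the closing edge costs the same
  amount again.\<close>

lemma sum_cyclic_sorted:
  fixes f :: "'a \<Rightarrow> real"
  assumes "sorted (map f H)" "H \<noteq> []" "\<And>x. x \<in> set H \<Longrightarrow> 0 \<le> f x \<and> f x \<le> 1"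
  shows "(\<Sum>i<length H. \<bar>f (H ! i) - f (H ! ((i + 1) mod length H))\<bar>) \<le> 2"
proof -
  obtain m where m: "length H = Suc m" using assms(2) by (cases H) auto
  have "(\<Sum>i<m. \<bar>f (H ! i) - f (H ! ((i + 1) mod length H))\<bar>)
      = (\<Sum>i<m. f (H ! Suc i) - f (H ! i))"
  proof (intro sum.cong refl)
    fix i assume "i \<in> {..<m}"
    then have "f (H ! i) \<le> f (H ! Suc i)"
      using assms(1) m by (auto simp: sorted_iff_nth_Suc)
    then show "\<bar>f (H ! i) - f (H ! ((i + 1) mod length H))\<bar> = f (H ! Suc i) - f (H ! i)"
      using \<open>i \<in> {..<m}\<close> m by simp
  qed
  also have "\<dots> = f (H ! m) - f (H ! 0)" by (rule sum_lessThan_telescope)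
  finally have "(\<Sum>i<length H. \<bar>f (H ! i) - f (H ! ((i + 1) mod length H))\<bar>)
      = f (H ! m) - f (H ! 0) + \<bar>f (H ! m) - f (H ! 0)\<bar>" using m by simp
  moreover have "0 \<le> f (H ! m) \<and> f (H ! m) \<le> 1" "0 \<le> f (H ! 0) \<and> f (H ! 0) \<le> 1"
    using assms(3)[of "H ! m"] assms(3)[of "H ! 0"] m by auto
  ultimately show ?thesis by argo
qed

lemma s_HC_set_le:
  assumes k: "0 < k" and X: "X \<subseteq> unit_cube k" "finite X" "X \<noteq> {}"
  shows "s_HC_set k X \<le> root k (9 * sqrt ((25 / 9 * real k + 27) ^ k))"
proof -
  define C where "C = sqrt ((25 / 9 * real k + 27) ^ k)"
  \<comment> \<open>One digit per point suffices: truncation costs 3^-n on each of \<open>n\<close>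
    edges, in total \<open>n / 3 ^ n \<le> 1\<close>.\<close>
  define n where "n = card X"
  define f where "f = peano_time k n 0"
  obtain L where L: "set L = X" "distinct L" using finite_distinct_list X(2) by blast
  define H where "H = sort_key f L"
  have H: "set H = X" "distinct H" "sorted (map f H)" using L by (auto simp: H_def)
  have len: "length H = n" using H distinct_card by (fastforce simp: n_def)
  have n: "0 < n" using X by (simp add: n_def card_gt_0_iff)
  have cube: "in_cube k x" if "x \<in> X" for x
    using X(1) that by (auto simp: in_cube_def unit_cube_def PiE_iff subset_iff)
  have "(\<Sum>i<n. eucl_dist k (H ! i) (H ! ((i + 1) mod n)) ^ k)
      \<le> (\<Sum>i<n. 3 * C * (\<bar>f (H ! i) - f (H ! ((i + 1) mod n))\<bar> + 1 / 3 ^ n))"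
    unfolding C_def f_def
    using H len n by (intro sum_mono peano_time_hoelder k cube)
      (metis lessThan_iff nth_mem, metis mod_less_divisor nth_mem)
  also have "\<dots> = 3 * C * ((\<Sum>i<n. \<bar>f (H ! i) - f (H ! ((i + 1) mod n))\<bar>) + real n / 3 ^ n)"
    by (simp add: sum_distrib_left[symmetric] sum.distrib)
  \<comment> \<open>2 from the cyclic sum of time differences, 1 from truncation.\<close>
  also have "\<dots> \<le> 3 * C * (2 + 1)"
  proof (intro mult_left_mono add_mono)
    show "(\<Sum>i<n. \<bar>f (H ! i) - f (H ! ((i + 1) mod n))\<bar>) \<le> 2"
      using sum_cyclic_sorted[OF H(3)] peano_time_bounds n len
      unfolding f_def by (fastforce simp: less_imp_le)
    have "real n \<le> 3 ^ n"
      using of_nat_mono[OF less_imp_le[OF less_exp[of n]], where 'a=real]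
        power_mono[of 2 "3::real" n] by simp
    then show "real n / 3 ^ n \<le> 1" by simp
  qed (simp add: C_def)
  finally have "s_cycle k H \<le> root k (9 * C)"
    using k by (simp add: s_cycle_def len)
  moreover have "s_HC_set k X \<le> s_cycle k H"
    unfolding s_HC_set_def using H
    by (intro Min_le finite_imageI finite_ham_cycles[OF X(2)]) (simp add: ham_cycle_def)
  ultimately show ?thesis by (simp add: C_def)
qed

text \<open>The gap between 5/3 and 2.91 absorbs both the factor 9 and the summand 27 already from
  \<open>k = 27\<close> on.\<close>

lemma root_bound:
  assumes "27 \<le> k"
  shows "root k (9 * sqrt ((25 / 9 * real k + 27) ^ k)) \<le> 2.91 * sqrt (real k)"
proof -
  have k: "0 < k" using assms by simp
  \<comment> \<open>After squaring, crude bounds suffice: \<open>81 \<le> 2 ^ k\<close> and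
    \<open>25 / 9 * k + 27 \<le> 4 * k\<close> give (8k)^k, and 8 < 2.91^2 = 8.4681.\<close>
  have "81 * (25 / 9 * real k + 27) ^ k \<le> 2 ^ k * (4 * real k) ^ k"
  proof (intro mult_mono power_mono)
    have "(2::real) ^ 7 \<le> 2 ^ k" using assms by (intro power_increasing) auto
    then show "(81::real) \<le> 2 ^ k" by simp
  qed (use assms in auto)
  also have "\<dots> = (2 * (4 * real k)) ^ k" by (rule power_mult_distrib[symmetric])
  also have "\<dots> \<le> ((2.91 * sqrt (real k))\<^sup>2) ^ k"
    by (intro power_mono) (auto simp: power2_eq_square)
  also have "\<dots> = ((2.91 * sqrt (real k)) ^ k)\<^sup>2" by (simp only: power_mult[symmetric] mult.commute)
  finally have "sqrt (81 * (25 / 9 * real k + 27) ^ k) \<le> (2.91 * sqrt (real k)) ^ k"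
    by (intro real_le_lsqrt) auto
  then have "9 * sqrt ((25 / 9 * real k + 27) ^ k) \<le> (2.91 * sqrt (real k)) ^ k"
    by (simp add: real_sqrt_mult)
  then have "root k (9 * sqrt ((25 / 9 * real k + 27) ^ k)) \<le> root k ((2.91 * sqrt (real k)) ^ k)"
    using k by simp
  then show ?thesis using k by (simp add: real_root_power_cancel)
qed

theorem theorem1p6:
  "\<exists>\<epsilon> :: nat \<Rightarrow> real. \<epsilon> \<longlonglongrightarrow> 0 \<and>
     (\<forall>\<^sub>F k in sequentially. s_HC k \<le> ereal (2.91 * sqrt (real k) * (1 + \<epsilon> k)))"
proof (intro exI[of _ "\<lambda>_. 0"] conjI tendsto_const eventually_sequentiallyI[of 27])
  \<comment> \<open>The error term is 0, since \<open>root_bound\<close> has no lower-order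
    loss.\<close>
  fix k :: nat assume k: "27 \<le> k"
  show "s_HC k \<le> ereal (2.91 * sqrt (real k) * (1 + 0))"
    unfolding s_HC_def s_HC_card_def
  proof (intro SUP_least)
    fix n X assume n: "n \<in> {2::nat..}"
      and X: "X \<in> {X. X \<subseteq> unit_cube k \<and> finite X \<and> card X = n}"
    then have "s_HC_set k X \<le> root k (9 * sqrt ((25 / 9 * real k + 27) ^ k))"
      using k by (intro s_HC_set_le) auto
    then show "ereal (s_HC_set k X) \<le> ereal (2.91 * sqrt (real k) * (1 + 0))"
      using root_bound[OF k] by simp
  qed
qed

end
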